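(* Assume that $g$ has no zeros or poles on the unit circle. If $p(z)$ has $Q$ roots inside the unit circle, then for $n$ large enough $H(z)$ has $2Q$ special roots (counting algebraic multiplicity).
   Context: Let $n\ge1$ be an integer and $b_0,b_1,c_{-1},c_0\in\mathbb{C}$ (fixed, independent of $n$). Define $$H(z)=z^{2n}(b_1+b_0z+z^2)(c_{-1}+c_0z+z^2)-(b_1z^2+b_0z+1)(c_{-1}z^2+c_0z+1),$$ a polynomial of degree $2n+4$, $p(z)=(b_1z^2+b_0z+1)(c_{-1}z^2+c_0z+1)$, and let $g$ be the rational function $g(z)=\dfrac{p(z)}{z^4p(z^{-1})}=\dfrac{(b_1z^2+b_0z+1)(c_{-1}z^2+c_0z+1)}{(b_1+b_0z+z^2)(c_{-1}+c_0z+z^2)}$. Roots of $p$ inside the unit circle are counted with multiplicity. Differentiable functions $R,\Psi:\mathbb{R}\to\mathbb{R}$ are defined by requiring $g(e^{it})=R(t)e^{i\Psi(t)}$, with $R(t)=|g(e^{it})|$. A number $t\in[0,2\pi)$ is called a phase root if $e^{2int}=e^{i\Psi(t)}$. The constants: $0<\Delta<1$, $A_\Delta=\{z\in\mathbb{C}: 1-\Delta<|z|<1+\Delta\}$, and $C>1$, $D>0$ are chosen so that on $A_\Delta$ one has $C^{-1}<|g(z)|<C$ and $|g'(z)|<D$. For $n>CD/2$ there are exactly $2n+4-2Q$ phase roots $t_1<\dots<t_{2n+4-2Q}$ in $[0,2\pi)$. The approximation discs are $$B_k=\left\{z : |z-z_k^*|\le\frac{CD}{2(1-\Delta)n^2}\right\},\quad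 z_k^*=|g(e^{it_k})|^{\frac1{2n}}e^{it_k},\quad 1\le k\le 2n+4-2Q.$$ For $n>\max\{\frac{CD}{2(1-\Delta)},\frac C\Delta\}$ each $B_k$ contains a unique root of $H$. These $2n+4-2Q$ roots of $H$ contained in the discs $B_k$ are called regular roots; the remaining roots of $H$ are called special roots. *)

theory Defs
  imports "HOL-Analysis.Analysis" "HOL-Computational_Algebra.Polynomial"
begin

text \<open>The argument \<open>cm1\<close> stands for the coefficient with index \<open>-1\<close> throughout.\<close>

definition p_poly :: "complex \<Rightarrow> complex \<Rightarrow> complex \<Rightarrow> complex \<Rightarrow> complex poly" where
  "p_poly b0 b1 cm1 c0 = [:1, b0, b1:] * [:1, c0, cm1:]"

definition q_poly :: "complex \<Rightarrow> complex \<Rightarrow> complex \<Rightarrow> complex \<Rightarrow> complex poly" where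
  "q_poly b0 b1 cm1 c0 = [:b1, b0, 1:] * [:cm1, c0, 1:]"

lemma poly_q_poly:
  assumes "z \<noteq> 0"
  shows "poly (q_poly b0 b1 cm1 c0) z = z ^ 4 * poly (p_poly b0 b1 cm1 c0) (inverse z)"
  using assms by (simp add: p_poly_def q_poly_def field_simps power4_eq_xxxx)

definition H_poly :: "complex \<Rightarrow> complex \<Rightarrow> complex \<Rightarrow> complex \<Rightarrow> nat \<Rightarrow> complex poly" where
  "H_poly b0 b1 cm1 c0 n = monom 1 (2 * n) * q_poly b0 b1 cm1 c0 - p_poly b0 b1 cm1 c0"

definition g_fun :: "complex \<Rightarrow> complex \<Rightarrow> complex \<Rightarrow> complex \<Rightarrow> complex \<Rightarrow> complex" where
  "g_fun b0 b1 cm1 c0 z = poly (p_poly b0 b1 cm1 c0) z / poly (q_poly b0 b1 cm1 c0) z"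

text \<open>
  Zeros and poles of \<open>g\<close> on the unit circle are those of the fraction \<open>p/q\<close> as written, before
  any cancellation: a common zero of \<open>p\<close> and \<open>q\<close> on the circle is excluded as well.
  (Such a zero is a root of every \<open>H\<close> on the unit circle and is not counted by \<open>Q\<close>. For
  \<open>b0 = cm1 = c0 = 0\<close>, \<open>b1 = 1\<close> one has \<open>H = (z^2 + 1) * (z^(2*n+2) - 1)\<close>, and for large
  even \<open>n\<close> there are two special roots although \<open>Q = 0\<close>.)
\<close>

definition no_zeros_poles_on_circle :: "complex \<Rightarrow> complex \<Rightarrow> complex \<Rightarrow> complex \<Rightarrow> bool" where
  "no_zeros_poles_on_circle b0 b1 cm1 c0 \<longleftrightarrow>
     (\<forall>z. cmod z = 1 \<longrightarrow>
        poly (p_poly b0 b1 cm1 c0) z \<noteq> 0 \<and> poly (q_poly b0 b1 cm1 c0) z \<noteq> 0)"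

definition root_count_in :: "complex poly \<Rightarrow> complex set \<Rightarrow> nat" where
  "root_count_in f S = (\<Sum>z | poly f z = 0 \<and> z \<in> S. order z f)"

definition annulus :: "real \<Rightarrow> complex set" where
  "annulus \<Delta> = {z. 1 - \<Delta> < cmod z \<and> cmod z < 1 + \<Delta>}"

text \<open>
  The bounds are required at the points of the annulus where the denominator of \<open>g\<close> does not
  vanish. They exclude poles of \<open>g\<close> in the annulus, so the remaining points are removable
  singularities of \<open>g\<close>; by the maximum principle (for \<open>g\<close>, \<open>1/g\<close> and the derivative of \<open>g\<close>)
  the strict bounds extend to them. Hence this is the condition on the rational function \<open>g\<close>,
  independently of the value 0 that HOL assigns to a quotient with denominator 0.
\<close>

definition annulus_bounds ::
  "complex \<Rightarrow> complex \<Rightarrow> complex \<Rightarrow> complex \<Rightarrow> real \<Rightarrow> real \<Rightarrow> real \<Rightarrow> bool" where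
  "annulus_bounds b0 b1 cm1 c0 \<Delta> C D \<longleftrightarrow>
     (\<forall>z \<in> annulus \<Delta>. poly (q_poly b0 b1 cm1 c0) z \<noteq> 0 \<longrightarrow>
        inverse C < cmod (g_fun b0 b1 cm1 c0 z) \<and> cmod (g_fun b0 b1 cm1 c0 z) < C \<and>
        cmod (deriv (g_fun b0 b1 cm1 c0) z) < D)"

definition phase_roots :: "(real \<Rightarrow> real) \<Rightarrow> nat \<Rightarrow> real set" where
  "phase_roots \<Psi> n = {t. 0 \<le> t \<and> t < 2 * pi \<and> cis (2 * real n * t) = cis (\<Psi> t)}"

definition approx_disc ::
  "complex \<Rightarrow> complex \<Rightarrow> complex \<Rightarrow> complex \<Rightarrow> real \<Rightarrow> real \<Rightarrow> real \<Rightarrow> nat \<Rightarrow> real \<Rightarrow> complex set" where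
  "approx_disc b0 b1 cm1 c0 \<Delta> C D n t =
     cball (of_real (cmod (g_fun b0 b1 cm1 c0 (cis t)) powr (1 / (2 * real n))) * cis t)
           (C * D / (2 * (1 - \<Delta>) * (real n)\<^sup>2))"

definition regular_roots ::
  "complex \<Rightarrow> complex \<Rightarrow> complex \<Rightarrow> complex \<Rightarrow> (real \<Rightarrow> real) \<Rightarrow> real \<Rightarrow> real \<Rightarrow> real \<Rightarrow> nat \<Rightarrow> complex set"
  where
  "regular_roots b0 b1 cm1 c0 \<Psi> \<Delta> C D n =
     {z. poly (H_poly b0 b1 cm1 c0 n) z = 0 \<and>
         (\<exists>t \<in> phase_roots \<Psi> n. z \<in> approx_disc b0 b1 cm1 c0 \<Delta> C D n t)}"

definition special_roots ::
  "complex \<Rightarrow> complex \<Rightarrow> complex \<Rightarrow> complex \<Rightarrow> (real \<Rightarrow> real) \<Rightarrow> real \<Rightarrow> real \<Rightarrow> real \<Rightarrow> nat \<Rightarrow> complex set"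
  where
  "special_roots b0 b1 cm1 c0 \<Psi> \<Delta> C D n =
     {z. poly (H_poly b0 b1 cm1 c0 n) z = 0} - regular_roots b0 b1 cm1 c0 \<Psi> \<Delta> C D n"

end

theory Submission
  imports Defs "HOL-Complex_Analysis.Complex_Analysis" "HOL-Real_Asymp.Real_Asymp"
begin

text \<open>
  Write \<open>p\<close>, \<open>q\<close> and \<open>H = z\<^sup>2\<^sup>n q - p\<close> for the polynomials and \<open>g = p / q\<close>. For large \<open>n\<close> the
  special roots turn out to be the roots of \<open>H\<close> that lie outside a fixed annulus around the unit
  circle; the annulus is so thin that it contains no zeros of \<open>p\<close> and \<open>q\<close>.

  Roots away from the circle are easy to count. Inside, \<open>z\<^sup>2\<^sup>n q\<close> is negligible, so by Rouche's theorem
  \<open>H\<close> has as many roots there as \<open>p\<close>, namely \<open>Q\<close> (\<open>root_count_H_inside\<close>). Outside there are \<open>Q\<close> more,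
  since \<open>H\<close> is antipalindromic and inversion maps its roots to its roots (\<open>root_count_in_outside\<close>).

  The approximation discs shrink to the circle (\<open>approx_disc_near_circle\<close>), so regular roots
  lie in the annulus. It remains to show that, conversely, every root in the annulus lies in one of
  the discs (\<open>roots_near_circle_in_disc\<close>).
  With \<open>z = exp w\<close> and a logarithm \<open>g (exp w) = exp (G w)\<close>, the equation \<open>z\<^sup>2\<^sup>n = g z\<close> becomes
  \<open>2 n w = G w + \<i> m\<close> with \<open>m\<close> a multiple of \<open>2 pi\<close>. The real number \<open>t\<close> with
  \<open>2 n t = Im (G (\<i> t)) + m\<close> is a phase root up to a multiple of \<open>2 pi\<close>, and the centre of its
  disc is \<open>exp w'\<close> with \<open>2 n w' = G (\<i> t) + \<i> m\<close>. Hence \<open>w - w' = (G w - G (\<i> t)) / (2 n)\<close>,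
  which is roughly at most \<open>\<bar>G'\<bar> \<bar>Re G\<bar> / (4 n\<^sup>2)\<close> (\<open>solution_close_to_explicit_point\<close>).

  The radius of the discs is \<open>D / (2 n\<^sup>2)\<close> or more, so the product \<open>\<bar>G'\<bar> \<bar>Re G\<bar>\<close> has to be compared
  with \<open>D\<close>. The separate bounds \<open>\<bar>G'\<bar> \<le> C D\<close> near the circle and \<open>\<bar>Re G\<bar> \<le> ln C\<close> do not suffice
  for large \<open>C\<close>. But the symmetry \<open>g (1/z) = 1 / g z\<close> gives \<open>\<bar>G'\<bar> \<le> D exp (- \<bar>Re G\<bar>)\<close> on the
  imaginary axis, and nearly so in its neighbourhood (\<open>ex_strip_logarithm\<close>). As
  \<open>x exp (- x) \<le> 1/2\<close>, this leaves room for all lower order terms.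
\<close>

section \<open>Counting roots of polynomials\<close>

lemma zorder_poly_eq_order:
  fixes f :: "complex poly"
  assumes "f \<noteq> 0"
  shows "zorder (poly f) a = int (order a f)"
proof -
  obtain h where h: "f = [:- a, 1:] ^ order a f * h" "\<not> [:- a, 1:] dvd h"
    using order_decomp[OF assms] by blast
  show ?thesis
  proof (rule zorder_eqI[where S = UNIV and g = "poly h"])
    show "poly h a \<noteq> 0" using h(2) by (simp add: poly_eq_0_iff_dvd)
    show "poly f w = poly h w * (w - a) powi int (order a f)" for w
      by (subst h(1)) (simp add: poly_power)
  qed (auto intro: holomorphic_intros)
qed

lemma root_count_in_Un:
  assumes "f \<noteq> 0" "S \<inter> T = {}"
  shows "root_count_in f (S \<union> T) = root_count_in f S + root_count_in f T"
proof -
  have "{z. poly f z = 0 \<and> z \<in> S \<union> T} = {z. poly f z = 0 \<and> z \<in> S} \<union> {z. poly f z = 0 \<and> z \<in> T}"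
    by auto
  then show ?thesis
    unfolding root_count_in_def using assms poly_roots_finite[OF assms(1)]
    by (simp only:) (subst sum.union_disjoint; auto)
qed

text \<open>
  Rouche's theorem, with zeros counted by the algebraic order of a root: the winding number of the
  circle is 1 around points inside and 0 around points outside.
\<close>
lemma root_count_in_disc_Rouche:
  fixes f h :: "complex poly" and r :: real
  assumes "r > 0" and less: "\<And>z. cmod z = r \<Longrightarrow> cmod (poly h z) < cmod (poly f z)"
  shows "root_count_in (f + h) {z. cmod z < r} = root_count_in f {z. cmod z < r}"
proof -
  have nz: "f \<noteq> 0" "f + h \<noteq> 0"
  proof -
    have *: "cmod (poly h (of_real r)) < cmod (poly f (of_real r))" using less \<open>r > 0\<close> by simp
    then show "f \<noteq> 0" by auto
    show "f + h \<noteq> 0"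
    proof
      assume "f + h = 0"
      then have "h = - f" by (simp add: eq_neg_iff_add_eq_0 add.commute)
      with * show False by simp
    qed
  qed
  have nroot: "poly f z \<noteq> 0" "poly (f + h) z \<noteq> 0" if "cmod z = r" for z
  proof -
    have *: "cmod (poly h z) < cmod (poly f z)" using less that by simp
    then show "poly f z \<noteq> 0" by auto
    show "poly (f + h) z \<noteq> 0"
    proof
      assume "poly (f + h) z = 0"
      then have "poly h z = - poly f z" by (simp add: eq_neg_iff_add_eq_0 add.commute)
      with * show False by simp
    qed
  qed
  have count: "(\<Sum>a\<in>{a \<in> UNIV. poly k a = 0}. winding_number (circlepath 0 r) a * zorder (poly k) a)
      = of_nat (root_count_in k {z. cmod z < r})"
    if k: "k \<noteq> 0" "\<And>z. cmod z = r \<Longrightarrow> poly k z \<noteq> 0" for k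
  proof -
    have fin: "finite {z. poly k z = 0}" by (rule poly_roots_finite[OF k(1)])
    have "(\<Sum>a\<in>{a \<in> UNIV. poly k a = 0}. winding_number (circlepath 0 r) a * zorder (poly k) a)
      = (\<Sum>a\<in>{a. poly k a = 0}. if cmod a < r then of_nat (order a k) else 0)"
    proof (rule sum.cong, goal_cases)
      case (2 a)
      then consider "cmod a < r" | "cmod a > r" using k(2) by force
      then show ?case
      proof cases
        case 1
        then show ?thesis
          by (simp add: zorder_poly_eq_order[OF k(1)] winding_number_circlepath)
      next
        case 2
        have "winding_number (circlepath 0 r) a = 0"
          by (rule winding_number_zero_outside[where s = "cball 0 r"])
             (use 2 \<open>r > 0\<close> in auto)
        with 2 show ?thesis by simp
      qed
    qed auto
    also have "\<dots> = of_nat (root_count_in k {z. cmod z < r})"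
      unfolding root_count_in_def of_nat_sum
      by (rule sum.mono_neutral_cong_right) (use fin in auto)
    finally show ?thesis .
  qed
  have "(\<Sum>a\<in>{a \<in> UNIV. poly f a + poly h a = 0}.
        winding_number (circlepath 0 r) a * zorder (\<lambda>a. poly f a + poly h a) a)
      = (\<Sum>a\<in>{a \<in> UNIV. poly f a = 0}. winding_number (circlepath 0 r) a * zorder (poly f) a)"
  proof (rule Rouche_theorem)
    show "finite {a \<in> UNIV. poly f a + poly h a = 0}"
      using poly_roots_finite[OF nz(2)] by simp
    show "finite {a \<in> UNIV. poly f a = 0}" using poly_roots_finite[OF nz(1)] by simp
  qed (use less \<open>r > 0\<close> in \<open>auto intro: holomorphic_intros\<close>)
  moreover have "(\<lambda>a. poly f a + poly h a) = poly (f + h)" by auto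
  ultimately have "of_nat (root_count_in (f + h) {z. cmod z < r})
      = (of_nat (root_count_in f {z. cmod z < r}) :: complex)"
    using count[OF nz(1) nroot(1)] count[OF nz(2) nroot(2)] by simp
  then show ?thesis by (simp only: of_nat_eq_iff)
qed

text \<open>
  Reflection is multiplicative and maps the factor belonging to \<open>a\<close> to a nonzero multiple of the one
  belonging to \<open>inverse a\<close>.
\<close>
lemma order_reflect_poly:
  fixes f :: "'a :: field poly"
  assumes "f \<noteq> 0" and "a \<noteq> 0"
  shows "order (inverse a) (reflect_poly f) = order a f"
proof -
  obtain h where h: "f = [:- a, 1:] ^ order a f * h" "\<not> [:- a, 1:] dvd h"
    using order_decomp[OF assms(1)] by blast
  define m where "m = order a f"
  have "h \<noteq> 0" using h(2) by auto
  have "poly h a \<noteq> 0" using h(2) by (simp add: poly_eq_0_iff_dvd)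
  then have r: "poly (reflect_poly h) (inverse a) \<noteq> 0"
    using assms(2) by (simp add: poly_reflect_poly_nz)
  have lin: "reflect_poly [:- a, 1:] = smult (- a) [:- inverse a, 1:]"
    using assms(2) by (simp add: reflect_poly_def)
  have eq: "reflect_poly f = smult ((- a) ^ m) ([:- inverse a, 1:] ^ m) * reflect_poly h"
    by (subst h(1)) (simp only: reflect_poly_mult reflect_poly_power lin smult_power m_def)
  have "order (inverse a) (reflect_poly f)
      = order (inverse a) (smult ((- a) ^ m) ([:- inverse a, 1:] ^ m)) + order (inverse a) (reflect_poly h)"
    unfolding eq by (rule order_mult) (use \<open>h \<noteq> 0\<close> assms(2) in auto)
  also have "\<dots> = m"
    using order_0I[OF r] order_power_n_n[of "inverse a" m] assms(2) by (simp add: order_smult)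
  finally show ?thesis by (simp add: m_def)
qed

text \<open>
  Inversion permutes the roots of an antipalindromic polynomial and preserves their orders.
\<close>
lemma root_count_in_outside:
  assumes nz: "f \<noteq> 0" and refl: "reflect_poly f = - f" and "r > 0" and p0: "poly f 0 \<noteq> 0"
  shows "root_count_in f {z. cmod z > inverse r} = root_count_in f {z. cmod z < r}"
  unfolding root_count_in_def
proof (rule sum.reindex_bij_witness[where i = inverse and j = inverse])
  have root: "poly f (inverse z) = 0" if "poly f z = 0" for z
  proof -
    have "z \<noteq> 0" using that p0 by auto
    then have "poly (reflect_poly f) (inverse z) = 0"
      using that by (simp add: poly_reflect_poly_nz)
    then show ?thesis by (simp add: refl)
  qed
  show "inverse z \<in> {z. poly f z = 0 \<and> z \<in> {z. cmod z < r}}"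
    if "z \<in> {z. poly f z = 0 \<and> z \<in> {z. inverse r < cmod z}}" for z
  proof -
    have "inverse (cmod z) < inverse (inverse r)"
      using that \<open>r > 0\<close> by (intro less_imp_inverse_less) auto
    then show ?thesis using that root by (simp add: norm_inverse)
  qed
  show "inverse z \<in> {z. poly f z = 0 \<and> z \<in> {z. inverse r < cmod z}}"
    if "z \<in> {z. poly f z = 0 \<and> z \<in> {z. cmod z < r}}" for z
  proof -
    have "z \<noteq> 0" using that p0 by auto
    then have "inverse r < inverse (cmod z)"
      using that \<open>r > 0\<close> by (intro less_imp_inverse_less) auto
    then show ?thesis using that root by (simp add: norm_inverse)
  qed
  show "order (inverse z) f = order z f"
    if "z \<in> {z. poly f z = 0 \<and> z \<in> {z. inverse r < cmod z}}" for z
  proof -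
    have "z \<noteq> 0" using that p0 by auto
    then show ?thesis using order_reflect_poly[OF nz, of z] by (simp add: refl)
  qed
qed auto

text \<open>
  The degree of \<open>H\<close> is \<open>2 * n + 4\<close> even if \<open>p\<close> has degree less than 4, since \<open>q\<close> is monic.
  Reflection exchanges the two terms of \<open>H\<close> because \<open>q(z) = z\<^sup>4 p(1/z)\<close>.
\<close>
lemma H_poly_antipalindromic:
  assumes "n \<ge> 1"
  shows "reflect_poly (H_poly b0 b1 cm1 c0 n) = - H_poly b0 b1 cm1 c0 n"
proof -
  let ?H = "H_poly b0 b1 cm1 c0 n" and ?p = "p_poly b0 b1 cm1 c0" and ?q = "q_poly b0 b1 cm1 c0"
  have dq: "degree ?q = 4" by (simp add: q_poly_def degree_mult_eq numeral_eq_Suc)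
  have "degree ?p \<le> degree [:1, b0, b1:] + degree [:1, c0, cm1:]"
    unfolding p_poly_def by (rule degree_mult_le)
  also have "\<dots> \<le> 4" by (auto simp: numeral_eq_Suc)
  finally have dp: "degree ?p \<le> 4" .
  have "?q \<noteq> 0" using dq by auto
  then have dmq: "degree (monom 1 (2 * n) * ?q) = 2 * n + 4"
    by (simp add: degree_mult_eq degree_monom_eq monom_eq_0_iff dq)
  have dH: "degree ?H = 2 * n + 4"
    unfolding H_poly_def diff_conv_add_uminus
    by (subst degree_add_eq_left) (use dmq dp assms in auto)
  have "poly (reflect_poly ?H) z = poly (- ?H) z" if "z \<noteq> 0" for z
  proof -
    have q: "poly ?q (inverse z) = poly ?p z / z ^ 4"
      using poly_q_poly[of "inverse z" b0 b1 cm1 c0] that by (simp add: field_simps)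
    have q': "poly ?p (inverse z) = poly ?q z / z ^ 4"
      using poly_q_poly[of z b0 b1 cm1 c0] that by (simp add: field_simps)
    have "poly ?H (inverse z) = poly ?p z / z ^ (2 * n + 4) - poly ?q z / z ^ 4"
      using that unfolding H_poly_def poly_diff poly_mult poly_monom q q'
      by (simp add: power_add field_simps)
    then show ?thesis
      using that unfolding poly_reflect_poly_nz[OF that] dH
      by (simp add: H_poly_def poly_monom power_add field_simps)
  qed
  then have "UNIV - {0} \<subseteq> {z. poly (reflect_poly ?H + ?H) z = 0}"
    by auto
  moreover have "infinite (UNIV - {0 :: complex})"
    by (simp add: infinite_UNIV_char_0)
  ultimately have "reflect_poly ?H + ?H = 0"
    using poly_roots_finite finite_subset by blast
  then show ?thesis by (simp add: eq_neg_iff_add_eq_0)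
qed

section \<open>A fixed point equation near the imaginary axis\<close>

definition strip :: "real \<Rightarrow> complex set" where
  "strip d = {w. \<bar>Re w\<bar> < d}"

lemma convex_strip: "convex (strip d)"
proof -
  have "strip d = {w. Re w < d} \<inter> {w. Re w > - d}" by (auto simp: strip_def)
  then show ?thesis by (simp add: convex_Int convex_halfspace_Re_lt convex_halfspace_Re_gt)
qed

lemma open_strip: "open (strip d)"
proof -
  have "strip d = {w. Re w < d} \<inter> {w. Re w > - d}" by (auto simp: strip_def)
  then show ?thesis by (simp add: open_Int open_halfspace_Re_lt open_halfspace_Re_gt)
qed

text \<open>
  The maximum of \<open>x exp (-x)\<close> is \<open>1/e\<close>. The gap between \<open>1/2\<close> and the bound 1 that
  \<open>x \<le> exp x\<close> would give pays for the lower order terms in the estimate below.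
\<close>
lemma mult_exp_minus_le_half:
  fixes x :: real
  assumes "x \<ge> 0"
  shows "x * exp (- x) \<le> 1 / 2"
proof -
  have "1 + x + x\<^sup>2 / 2 \<le> exp x" using exp_lower_Taylor_quadratic[OF assms] by simp
  moreover have "0 \<le> (x - 1)\<^sup>2" by simp
  ultimately have "2 * x \<le> exp x" by (simp add: power2_eq_square algebra_simps)
  then show ?thesis by (simp add: exp_minus field_simps)
qed

text \<open>The map \<open>t \<mapsto> (Im (G (\<i> t)) + m) / k\<close> is a contraction of the real line.\<close>
lemma ex_real_solution_on_axis:
  fixes G :: "complex \<Rightarrow> complex" and m K k :: real
  assumes "d > 0" and lip: "\<And>u v. u \<in> strip d \<Longrightarrow> v \<in> strip d \<Longrightarrow> cmod (G u - G v) \<le> K * cmod (u - v)"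
    and "K \<ge> 0" and "K < k"
  shows "\<exists>t. k * t = Im (G (\<i> * of_real t)) + m"
proof -
  have "k > 0" using assms by simp
  have "\<exists>!t. (Im (G (\<i> * of_real t)) + m) / k = t"
  proof (rule banach_fix_type[where c = "K / k"])
    show "\<forall>x y. dist ((Im (G (\<i> * of_real x)) + m) / k) ((Im (G (\<i> * of_real y)) + m) / k)
        \<le> K / k * dist x y"
    proof (intro allI)
      fix x y :: real
      have "\<bar>Im (G (\<i> * of_real x)) - Im (G (\<i> * of_real y))\<bar> \<le> cmod (G (\<i> * of_real x) - G (\<i> * of_real y))"
        using abs_Im_le_cmod[of "G (\<i> * of_real x) - G (\<i> * of_real y)"] by simp
      also have "\<dots> \<le> K * cmod (\<i> * of_real x - \<i> * of_real y)"
        using assms(1) by (intro lip) (auto simp: strip_def)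
      also have "cmod (\<i> * of_real x - \<i> * of_real y) = \<bar>x - y\<bar>"
        by (simp flip: right_diff_distrib of_real_diff add: norm_mult)
      finally have *: "\<bar>Im (G (\<i> * of_real x)) - Im (G (\<i> * of_real y))\<bar> \<le> K * \<bar>x - y\<bar>" .
      have "dist ((Im (G (\<i> * of_real x)) + m) / k) ((Im (G (\<i> * of_real y)) + m) / k)
          = \<bar>Im (G (\<i> * of_real x)) - Im (G (\<i> * of_real y))\<bar> / k"
        using \<open>k > 0\<close> by (simp add: dist_real_def flip: diff_divide_distrib)
      also have "\<dots> \<le> K * \<bar>x - y\<bar> / k" using * \<open>k > 0\<close> by (simp add: divide_right_mono)
      finally show "dist ((Im (G (\<i> * of_real x)) + m) / k) ((Im (G (\<i> * of_real y)) + m) / k)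
        \<le> K / k * dist x y" by (simp add: dist_real_def)
    qed
  qed (use assms in auto)
  then obtain t where "(Im (G (\<i> * of_real t)) + m) / k = t" by blast
  then show ?thesis using \<open>k > 0\<close> by (intro exI[of _ t]) (simp add: field_simps)
qed

text \<open>
  The setting for the logarithm \<open>G\<close> of \<open>g\<close> in the coordinate \<open>w\<close> with \<open>z = exp w\<close>. The bound on the
  derivative becomes small where \<open>\<bar>Re (G w)\<bar>\<close> is large. This matters because a solution of
  \<open>2 n w = G w + \<i> m\<close> has distance about \<open>\<bar>Re (G w)\<bar> / (2 n)\<close> from the imaginary axis, and what
  enters below is the product of the two quantities.
\<close>
locale strip_function =
  fixes d c D :: real and G :: "complex \<Rightarrow> complex"
  assumes d_pos: "d > 0" and c_nonneg: "c \<ge> 0" and D_pos: "D > 0"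
    and holo: "G holomorphic_on strip d"
    and Re_bound: "\<And>w. w \<in> strip d \<Longrightarrow> \<bar>Re (G w)\<bar> \<le> c"
    and deriv_bound: "\<And>w. w \<in> strip d \<Longrightarrow> cmod (deriv G w) \<le> D * exp (\<bar>Re w\<bar> - \<bar>Re (G w)\<bar>)"
begin

text \<open>
  For real \<open>t\<close> with \<open>2 n t = Im (G (\<i> t)) + m\<close>, the point \<open>w' = \<i> t + Re (G (\<i> t)) / (2 n)\<close>
  satisfies \<open>2 n w' = G (\<i> t) + \<i> m\<close>, that is, \<open>w'\<close> is the result of one fixed point iteration
  started at \<open>\<i> t\<close>. Hence \<open>2 n (w - w') = G w - G (\<i> t)\<close>. The mean value inequality bounds the
  right-hand side by a multiple of the distance of \<open>w\<close> and \<open>\<i> t\<close>, which is at most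
  \<open>\<bar>w - w'\<bar> + \<bar>Re (G (\<i> t))\<bar> / (2 n)\<close>. This is used twice: with the Lipschitz constant \<open>K\<close> of
  the whole strip it shows that \<open>w\<close> and \<open>\<i> t\<close> are within \<open>O(1/n)\<close>; on the segment between them
  \<open>G\<close> is then almost constant, and the Lipschitz constant improves to
  \<open>3/2 * D * exp (- \<bar>Re (G (\<i> t))\<bar>)\<close>.
\<close>
lemma solution_close_to_explicit_point:
  "\<forall>\<^sub>F n in sequentially. \<forall>w\<in>strip d. \<forall>m::real.
    2 * of_nat n * w = G w + \<i> * of_real m \<longrightarrow>
    (\<exists>t::real. 2 * real n * t = Im (G (\<i> * of_real t)) + m \<and>
       cmod (w - (\<i> * of_real t + of_real (Re (G (\<i> * of_real t)) / (2 * real n)))) \<le> D / (4 * (real n)\<^sup>2))"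
proof -
  define K where "K = D * exp d"
  have "K > 0" using D_pos by (simp add: K_def)
  have der: "(G has_field_derivative deriv G w) (at w within T)" if "w \<in> strip d" for w T
    using holomorphic_derivI[OF holo open_strip that] .
  have lip: "cmod (G u - G v) \<le> K * cmod (u - v)" if "u \<in> strip d" "v \<in> strip d" for u v
  proof (rule field_differentiable_bound[OF convex_strip der])
    fix z assume z: "z \<in> strip d"
    then have "D * exp (\<bar>Re z\<bar> - \<bar>Re (G z)\<bar>) \<le> K"
      unfolding K_def using D_pos by (intro mult_left_mono) (auto simp: strip_def)
    with deriv_bound[OF z] show "cmod (deriv G z) \<le> K" by linarith
  qed (use that in auto)
  define \<mu> where "\<mu> n = K * c / (2 * (real n)\<^sup>2) + c / (2 * real n)" for n
  \<comment> \<open>\<open>\<mu> n\<close> will bound the distance of \<open>w\<close> and \<open>\<i> t\<close>.\<close>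
  have "(\<lambda>n. exp (\<mu> n + K * \<mu> n)) \<longlonglongrightarrow> exp 0"
    unfolding \<mu>_def by (rule tendsto_exp) real_asymp
  then have ev: "\<forall>\<^sub>F n in sequentially. exp (\<mu> n + K * \<mu> n) < 3 / 2"
    by (rule order_tendstoD) simp
  have "\<forall>\<^sub>F n in sequentially. real n > max K (3 * D)" by real_asymp
  then show ?thesis using ev
  proof eventually_elim
    case (elim n)
    then have n: "real n > K" "real n > 3 * D" "real n > 0" using \<open>K > 0\<close> by auto
    show ?case
    proof (intro ballI allI impI)
      fix w m assume w: "w \<in> strip d" and eq: "2 * of_nat n * w = G w + \<i> * of_real m"
      obtain t where t: "2 * real n * t = Im (G (\<i> * of_real t)) + m"
        using ex_real_solution_on_axis[OF d_pos lip, of "2 * real n" m] n \<open>K > 0\<close> by auto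
      define s where "s = \<i> * complex_of_real t"
      define w' where "w' = s + of_real (Re (G s) / (2 * real n))"
      have s: "s \<in> strip d" using d_pos by (simp add: s_def strip_def)
      define \<sigma> where "\<sigma> = \<bar>Re (G s)\<bar>"
      have \<sigma>: "0 \<le> \<sigma>" "\<sigma> \<le> c" using Re_bound[OF s] by (auto simp: \<sigma>_def)
      have w': "2 * of_nat n * w' = G s + \<i> * of_real m"
        using t n by (auto simp: w'_def s_def complex_eq_iff algebra_simps)
      define e where "e = cmod (w - w')"
      have "2 * of_nat n * (w - w') = G w - G s" using eq w' by (simp add: algebra_simps)
      then have "cmod (2 * of_nat n * (w - w')) = cmod (G w - G s)" by simp
      then have e: "2 * real n * e = cmod (G w - G s)" by (simp add: e_def norm_mult)
      have ws: "cmod (w - s) \<le> e + \<sigma> / (2 * real n)"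
      proof -
        have "cmod (w - s) \<le> cmod (w - w') + cmod (w' - s)"
          using norm_triangle_ineq[of "w - w'" "w' - s"] by simp
        also have "cmod (w' - s) = \<sigma> / (2 * real n)"
          unfolding w'_def \<sigma>_def by (simp add: norm_divide norm_mult)
        finally show ?thesis by (simp add: e_def)
      qed
      have "e \<ge> 0" by (simp add: e_def)
      have bootstrap: "e \<le> L * (\<sigma> / (2 * real n)) / (2 * real n - L)"
        if L: "cmod (G w - G s) \<le> L * cmod (w - s)" "0 \<le> L" "L < 2 * real n" for L
      proof -
        have "2 * real n * e \<le> L * (e + \<sigma> / (2 * real n))"
          using e L(1) mult_left_mono[OF ws L(2)] by linarith
        then have "e * (2 * real n - L) \<le> L * (\<sigma> / (2 * real n))" by (simp add: algebra_simps)
        then show ?thesis using L(3) by (subst pos_le_divide_eq) auto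
      qed
      have "e \<le> K * (\<sigma> / (2 * real n)) / (2 * real n - K)"
        using lip[OF w s] n \<open>K > 0\<close> by (intro bootstrap) auto
      also have "\<dots> \<le> K * (c / (2 * real n)) / real n"
        using n \<open>K > 0\<close> \<sigma> by (intro frac_le mult_left_mono divide_right_mono mult_nonneg_nonneg divide_nonneg_nonneg) auto
      also have "\<dots> = K * c / (2 * (real n)\<^sup>2)" by (simp add: power2_eq_square)
      finally have e1: "e \<le> K * c / (2 * (real n)\<^sup>2)" .
      have "\<sigma> / (2 * real n) \<le> c / (2 * real n)" using \<sigma> n by (intro divide_right_mono) auto
      then have ws\<mu>: "cmod (w - s) \<le> \<mu> n" using ws e1 unfolding \<mu>_def by linarith
      define L where "L = 3 / 2 * D * exp (- \<sigma>)"
      have "L > 0" using D_pos by (simp add: L_def)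
      have "L \<le> 3 / 2 * D" using D_pos \<sigma> by (simp add: L_def)
      have "cmod (G w - G s) \<le> L * cmod (w - s)"
      proof (rule field_differentiable_bound[OF convex_closed_segment[of s w] der])
        fix z assume z: "z \<in> closed_segment s w"
        show zs: "z \<in> strip d"
          using closed_segment_subset[OF s w convex_strip] z by blast
        have "cmod (z - s) \<le> cmod (w - s)" using segment_bound1[OF z] by simp
        then have zs\<mu>: "cmod (z - s) \<le> \<mu> n" using ws\<mu> by linarith
        have "\<bar>Re z\<bar> \<le> \<mu> n"
          using abs_Re_le_cmod[of "z - s"] zs\<mu> by (simp add: s_def)
        moreover have "\<bar>Re (G z) - Re (G s)\<bar> \<le> K * \<mu> n"
        proof -
          have "\<bar>Re (G z) - Re (G s)\<bar> \<le> cmod (G z - G s)"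
            using abs_Re_le_cmod[of "G z - G s"] by simp
          also have "\<dots> \<le> K * cmod (z - s)" by (rule lip[OF zs s])
          also have "\<dots> \<le> K * \<mu> n" using zs\<mu> \<open>K > 0\<close> by (intro mult_left_mono) auto
          finally show ?thesis .
        qed
        ultimately have "\<bar>Re z\<bar> - \<bar>Re (G z)\<bar> \<le> (\<mu> n + K * \<mu> n) + (- \<sigma>)"
          unfolding \<sigma>_def by linarith
        then have "exp (\<bar>Re z\<bar> - \<bar>Re (G z)\<bar>) \<le> exp (\<mu> n + K * \<mu> n) * exp (- \<sigma>)"
          by (simp flip: exp_add)
        also have "\<dots> \<le> 3 / 2 * exp (- \<sigma>)" using elim(2) by (intro mult_right_mono) auto
        finally have "D * exp (\<bar>Re z\<bar> - \<bar>Re (G z)\<bar>) \<le> L"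
          unfolding L_def using D_pos by simp
        with deriv_bound[OF zs] show "cmod (deriv G z) \<le> L" by linarith
      qed auto
      then have "e \<le> L * (\<sigma> / (2 * real n)) / (2 * real n - L)"
        using \<open>L > 0\<close> \<open>L \<le> 3 / 2 * D\<close> n D_pos by (intro bootstrap) auto
      also have "L * (\<sigma> / (2 * real n)) = 3 / 2 * D * (\<sigma> * exp (- \<sigma>)) / (2 * real n)"
        by (simp add: L_def)
      also have "\<dots> / (2 * real n - L) \<le> (3 / 2 * D * (1 / 2) / (2 * real n)) / (3 / 2 * real n)"
        using n \<open>L \<le> 3 / 2 * D\<close> D_pos mult_exp_minus_le_half[OF \<sigma>(1)]
        by (intro frac_le divide_right_mono mult_left_mono divide_nonneg_nonneg) auto
      also have "\<dots> = D / (4 * (real n)\<^sup>2)" by (simp add: power2_eq_square)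
      finally have "e \<le> D / (4 * (real n)\<^sup>2)" .
      then show "\<exists>t::real. 2 * real n * t = Im (G (\<i> * of_real t)) + m \<and>
       cmod (w - (\<i> * of_real t + of_real (Re (G (\<i> * of_real t)) / (2 * real n)))) \<le> D / (4 * (real n)\<^sup>2)"
        using t unfolding e_def w'_def s_def by blast
    qed
  qed
qed

end

lemma cmod_exp_diff_le:
  assumes "Re u \<le> a" "Re v \<le> a"
  shows "cmod (exp u - exp v) \<le> exp a * cmod (u - v)"
  by (rule field_differentiable_bound[where S = "{z. Re z \<le> a}" and f' = exp])
     (use assms in \<open>auto intro!: derivative_eq_intros convex_halfspace_Re_le\<close>)

section \<open>The logarithm of g near the unit circle\<close>

text \<open>The image of the strip under the exponential function is an annulus around the unit circle.\<close>
locale strip_logarithm = strip_function d c D G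
  for d c D :: real and G :: "complex \<Rightarrow> complex" +
  fixes b0 b1 cm1 c0 :: complex
  assumes p_nz: "\<And>w. w \<in> strip d \<Longrightarrow> poly (p_poly b0 b1 cm1 c0) (exp w) \<noteq> 0"
    and q_nz: "\<And>w. w \<in> strip d \<Longrightarrow> poly (q_poly b0 b1 cm1 c0) (exp w) \<noteq> 0"
    and exp_G: "\<And>w. w \<in> strip d \<Longrightarrow> g_fun b0 b1 cm1 c0 (exp w) = exp (G w)"

lemma g_fun_inverse:
  assumes "z \<noteq> 0"
  shows "g_fun b0 b1 cm1 c0 (inverse z) = inverse (g_fun b0 b1 cm1 c0 z)"
proof -
  have "poly (q_poly b0 b1 cm1 c0) (inverse z) = poly (p_poly b0 b1 cm1 c0) z / z ^ 4"
    using poly_q_poly[of "inverse z" b0 b1 cm1 c0] assms by (simp add: field_simps)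
  moreover have "poly (p_poly b0 b1 cm1 c0) (inverse z) = poly (q_poly b0 b1 cm1 c0) z / z ^ 4"
    using poly_q_poly[of z b0 b1 cm1 c0] assms by (simp add: field_simps)
  ultimately show ?thesis using assms by (simp only: g_fun_def) simp
qed

lemma g_fun_DERIV:
  assumes "poly (q_poly b0 b1 cm1 c0) z \<noteq> 0"
  shows "(g_fun b0 b1 cm1 c0 has_field_derivative deriv (g_fun b0 b1 cm1 c0) z) (at z)"
proof -
  have "g_fun b0 b1 cm1 c0 field_differentiable at z"
    unfolding g_fun_def[abs_def] using assms
    by (intro derivative_intros)
       (auto simp: field_differentiable_def intro!: exI poly_DERIV)
  then show ?thesis by (simp add: DERIV_deriv_iff_field_differentiable)
qed

text \<open>
  Only finitely many values \<open>ln (cmod z)\<close> occur for roots \<open>z\<close> of \<open>p * q\<close>, and 0 is not among those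
  of nonzero roots. The value \<open>ln 0 = 0\<close> does no harm, as \<open>exp w\<close> is never 0.
\<close>
lemma ex_zero_free_strip:
  assumes "no_zeros_poles_on_circle b0 b1 cm1 c0"
  shows "\<exists>d>0. \<forall>w\<in>strip d. poly (p_poly b0 b1 cm1 c0) (exp w) \<noteq> 0 \<and> poly (q_poly b0 b1 cm1 c0) (exp w) \<noteq> 0"
proof -
  let ?f = "p_poly b0 b1 cm1 c0 * q_poly b0 b1 cm1 c0"
  have circle: "poly ?f z \<noteq> 0" if "cmod z = 1" for z
    using assms that by (simp add: no_zeros_poles_on_circle_def)
  from circle[of 1] have "?f \<noteq> 0" by auto
  then have "finite ((\<lambda>z. ln (cmod z)) ` {z. poly ?f z = 0})" using poly_roots_finite by blast
  from finite_set_avoid[OF this, of 0] obtain d where d: "d > 0"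
    "\<And>z. poly ?f z = 0 \<Longrightarrow> ln (cmod z) \<noteq> 0 \<Longrightarrow> d \<le> \<bar>ln (cmod z)\<bar>"
    by (auto simp: dist_real_def)
  have "poly ?f (exp w) \<noteq> 0" if "w \<in> strip d" for w
  proof
    assume root: "poly ?f (exp w) = 0"
    then have "Re w \<noteq> 0" using circle[of "exp w"] by auto
    then have "d \<le> \<bar>Re w\<bar>" using d(2)[OF root] by simp
    with that show False by (simp add: strip_def)
  qed
  with d(1) show ?thesis by (intro exI[of _ d]) auto
qed

text \<open>
  The logarithm exists because the strip is simply connected. From \<open>exp (G w) = g (exp w)\<close> one gets
  \<open>\<bar>G' w\<bar> = \<bar>g' (exp w)\<bar> exp (Re w - Re (G w)) \<le> D exp (Re w - Re (G w))\<close>, which is good where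
  \<open>\<bar>g\<bar>\<close> is large. The identity \<open>g (1/z) = 1 / g z\<close> says that \<open>G w + G (- w)\<close> is constant, so
  \<open>G' (- w) = G' w\<close>; the same estimate at \<open>- w\<close> is good where \<open>\<bar>g\<bar>\<close> is small.
\<close>
lemma ex_strip_logarithm:
  assumes nz: "no_zeros_poles_on_circle b0 b1 cm1 c0"
    and \<Delta>: "0 < \<Delta>" "\<Delta> < 1" and "C > 1" and "D > 0"
    and bounds: "annulus_bounds b0 b1 cm1 c0 \<Delta> C D"
  shows "\<exists>d G. strip_logarithm d (ln C) D G b0 b1 cm1 c0"
proof -
  let ?p = "p_poly b0 b1 cm1 c0" and ?q = "q_poly b0 b1 cm1 c0" and ?g = "g_fun b0 b1 cm1 c0"
  obtain d0 where d0: "d0 > 0"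
    and nz0: "\<And>w. w \<in> strip d0 \<Longrightarrow> poly ?p (exp w) \<noteq> 0 \<and> poly ?q (exp w) \<noteq> 0"
    using ex_zero_free_strip[OF nz] by blast
  define d where "d = min d0 (ln (1 + \<Delta>))"
  have "d > 0" using d0 \<Delta> by (simp add: d_def)
  have p_nz: "poly ?p (exp w) \<noteq> 0" and q_nz: "poly ?q (exp w) \<noteq> 0" if "w \<in> strip d" for w
    using nz0[of w] that by (auto simp: strip_def d_def)
  have annulus: "exp w \<in> annulus \<Delta>" if "w \<in> strip d" for w
  proof -
    have "Re w < ln (1 + \<Delta>)" "- Re w < ln (1 + \<Delta>)" using that by (auto simp: strip_def d_def)
    then have "exp (Re w) < exp (ln (1 + \<Delta>))" "exp (- Re w) < exp (ln (1 + \<Delta>))"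
      by (simp_all only: exp_less_mono)
    then have u: "exp (Re w) < 1 + \<Delta>" and l: "exp (- Re w) < 1 + \<Delta>" using \<Delta> by simp_all
    have "(1 - \<Delta>) * exp (- Re w) \<le> (1 - \<Delta>) * (1 + \<Delta>)"
      using l \<Delta> by (intro mult_left_mono) auto
    also have "\<dots> < 1" using \<Delta> by (simp add: algebra_simps)
    finally have "1 - \<Delta> < exp (Re w)" by (simp add: exp_minus field_simps)
    with u show ?thesis by (simp add: annulus_def)
  qed
  have g_bounds: "inverse C < cmod (?g (exp w))" "cmod (?g (exp w)) < C" "cmod (deriv ?g (exp w)) < D"
    if "w \<in> strip d" for w
    using bounds annulus[OF that] q_nz[OF that] by (auto simp: annulus_bounds_def)
  have "simply_connected (strip d)" by (simp add: convex_imp_simply_connected convex_strip)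
  then have log: "\<And>f. f holomorphic_on strip d \<Longrightarrow> (\<And>w. w \<in> strip d \<Longrightarrow> f w \<noteq> 0) \<Longrightarrow>
      \<exists>h. h holomorphic_on strip d \<and> (\<forall>w\<in>strip d. f w = exp (h w))"
    using simply_connected_eq_holomorphic_log[OF open_strip] by blast
  have "(\<lambda>w. ?g (exp w)) holomorphic_on strip d"
    unfolding g_fun_def using q_nz by (intro holomorphic_intros) auto
  moreover have "?g (exp w) \<noteq> 0" if "w \<in> strip d" for w
    using p_nz[OF that] q_nz[OF that] by (simp add: g_fun_def)
  ultimately obtain G where holo: "G holomorphic_on strip d"
    and G: "\<And>w. w \<in> strip d \<Longrightarrow> ?g (exp w) = exp (G w)"
    using log by blast
  have DG: "(G has_field_derivative deriv G w) (at w)" if "w \<in> strip d" for w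
    using holomorphic_derivI[OF holo open_strip that] .
  have Re_G: "\<bar>Re (G w)\<bar> \<le> ln C" if "w \<in> strip d" for w
  proof -
    have "inverse C < exp (Re (G w))" "exp (Re (G w)) < C"
      using g_bounds[OF that] G[OF that] by auto
    then have "exp (- ln C) < exp (Re (G w))" "exp (Re (G w)) < exp (ln C)"
      using \<open>C > 1\<close> by (auto simp: exp_minus)
    then show ?thesis by simp
  qed
  have deriv_G: "deriv G w = deriv ?g (exp w) * exp w / exp (G w)" if "w \<in> strip d" for w
  proof -
    have "((\<lambda>w. exp (G w)) has_field_derivative exp (G w) * deriv G w) (at w)"
      by (rule DERIV_fun_exp[OF DG[OF that]])
    moreover have "((\<lambda>w. ?g (exp w)) has_field_derivative deriv ?g (exp w) * exp w) (at w)"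
      by (rule DERIV_chain2[where f = ?g and g = exp, OF g_fun_DERIV[OF q_nz[OF that]] DERIV_exp])
    then have "((\<lambda>w. exp (G w)) has_field_derivative deriv ?g (exp w) * exp w) (at w)"
      by (rule has_field_derivative_transform_within_open[OF _ open_strip that]) (use G in auto)
    ultimately have "exp (G w) * deriv G w = deriv ?g (exp w) * exp w" by (rule DERIV_unique)
    then show ?thesis by (simp add: field_simps)
  qed
  have one_sided: "cmod (deriv G w) \<le> D * exp (Re w - Re (G w))" if "w \<in> strip d" for w
  proof -
    have "cmod (deriv G w) = cmod (deriv ?g (exp w)) * exp (Re w - Re (G w))"
      unfolding deriv_G[OF that] by (simp add: norm_mult norm_divide exp_diff)
    also have "\<dots> \<le> D * exp (Re w - Re (G w))"
      using g_bounds(3)[OF that] by (intro mult_right_mono) auto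
    finally show ?thesis .
  qed
  have mirror: "- w \<in> strip d" if "w \<in> strip d" for w using that by (simp add: strip_def)
  have exp_mirror: "exp (G (- w)) = exp (- G w)" if "w \<in> strip d" for w
    using g_fun_inverse[of "exp w" b0 b1 cm1 c0] G[OF that] G[OF mirror[OF that]]
    by (simp flip: exp_minus)
  have deriv_mirror: "deriv G (- w) = deriv G w" if "w \<in> strip d" for w
  proof -
    have "((\<lambda>w. exp (G (- w))) has_field_derivative exp (G (- w)) * (deriv G (- w) * (- 1))) (at w)"
      by (intro DERIV_fun_exp DERIV_chain2[where f = G and g = uminus, OF DG[OF mirror[OF that]]]
          DERIV_minus DERIV_ident)
    moreover have "((\<lambda>w. exp (- G w)) has_field_derivative exp (- G w) * (- deriv G w)) (at w)"
      by (rule DERIV_fun_exp[OF DERIV_minus[OF DG[OF that]]])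
    then have "((\<lambda>w. exp (G (- w))) has_field_derivative exp (- G w) * (- deriv G w)) (at w)"
      by (rule has_field_derivative_transform_within_open[OF _ open_strip that])
         (use exp_mirror in auto)
    ultimately have "exp (G (- w)) * (deriv G (- w) * (- 1)) = exp (- G w) * (- deriv G w)"
      by (rule DERIV_unique)
    then show ?thesis by (simp add: exp_mirror[OF that])
  qed
  have "cmod (deriv G w) \<le> D * exp (\<bar>Re w\<bar> - \<bar>Re (G w)\<bar>)" if w: "w \<in> strip d" for w
  proof -
    have "norm (exp (G (- w))) = norm (exp (- G w))" by (simp only: exp_mirror[OF w])
    then have "Re (G (- w)) = - Re (G w)" by simp
    then have "cmod (deriv G w) \<le> D * exp (- Re w + Re (G w))"
      using one_sided[OF mirror[OF w]] deriv_mirror[OF w] by simp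
    moreover have "D * exp (- Re w + Re (G w)) \<le> D * exp (\<bar>Re w\<bar> + Re (G w))"
      and "D * exp (Re w - Re (G w)) \<le> D * exp (\<bar>Re w\<bar> - Re (G w))"
      using \<open>D > 0\<close> by (intro mult_left_mono; simp)+
    ultimately have "cmod (deriv G w) \<le> D * exp (\<bar>Re w\<bar> + Re (G w))"
      and "cmod (deriv G w) \<le> D * exp (\<bar>Re w\<bar> - Re (G w))"
      using one_sided[OF w] by linarith+
    then show ?thesis by (cases "Re (G w) \<ge> 0") simp_all
  qed
  then have "strip_logarithm d (ln C) D G b0 b1 cm1 c0"
    using \<open>d > 0\<close> \<open>D > 0\<close> \<open>C > 1\<close> holo p_nz q_nz G Re_G by unfold_locales auto
  then show ?thesis by blast
qed

section \<open>Roots of H inside the circle and near it\<close>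

context strip_logarithm
begin

lemma near_circle_as_exp:
  assumes "exp (- d) < cmod z" "cmod z < exp d"
  obtains w where "w \<in> strip d" "z = exp w"
proof
  have z: "z \<noteq> 0" using assms exp_gt_zero[of "-d"] by (metis less_asym norm_zero)
  then have "\<bar>ln (cmod z)\<bar> < d"
    using assms ln_less_cancel_iff[of "exp (- d)" "cmod z"] ln_less_cancel_iff[of "cmod z" "exp d"]
    by auto
  then show "Ln z \<in> strip d" using z by (simp add: strip_def)
  show "z = exp (Ln z)" using z by simp
qed

text \<open>
  On the circle of radius \<open>exp (- d / 2)\<close> the modulus of \<open>p / q = g\<close> is bounded below, while
  \<open>\<bar>z\<^sup>2\<^sup>n\<bar> = exp (- d n)\<close> tends to 0. Hence \<open>- p\<close> dominates \<open>z\<^sup>2\<^sup>n q\<close> there.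
\<close>
lemma root_count_H_inside:
  "\<forall>\<^sub>F n in sequentially. root_count_in (H_poly b0 b1 cm1 c0 n) {z. cmod z < exp (- d / 2)}
     = root_count_in (p_poly b0 b1 cm1 c0) {z. cmod z < 1}"
proof -
  let ?p = "p_poly b0 b1 cm1 c0" and ?q = "q_poly b0 b1 cm1 c0"
  have "(\<lambda>n. exp (- (d * real n))) \<longlonglongrightarrow> 0" using d_pos by real_asymp
  then have "\<forall>\<^sub>F n in sequentially. exp (- (d * real n)) < exp (- c)"
    by (rule order_tendstoD) simp
  then show ?thesis
  proof eventually_elim
    case (elim n)
    have Rouche: "root_count_in (- ?p + monom 1 (2 * n) * ?q) {z. cmod z < exp (- d / 2)}
        = root_count_in (- ?p) {z. cmod z < exp (- d / 2)}"
    proof (rule root_count_in_disc_Rouche)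
      fix z assume z: "cmod z = exp (- d / 2)"
      then have "exp (- d) < cmod z" "cmod z < exp d" using d_pos by auto
      then obtain w where w: "w \<in> strip d" "z = exp w" by (rule near_circle_as_exp)
      have "cmod (z ^ (2 * n)) = exp (- (d * real n))"
        unfolding norm_power z by (simp flip: exp_of_nat_mult)
      also have "\<dots> < exp (- c)" by (rule elim)
      also have "\<dots> \<le> exp (Re (G w))" using Re_bound[OF w(1)] by simp
      also have "\<dots> = cmod (poly ?p z) / cmod (poly ?q z)"
        using exp_G[OF w(1)] w(2) by (metis g_fun_def norm_divide norm_exp_eq_Re)
      finally have "cmod (z ^ (2 * n)) * cmod (poly ?q z) < cmod (poly ?p z)"
        using q_nz[OF w(1)] w(2) by (simp add: pos_less_divide_eq)
      then show "cmod (poly (monom 1 (2 * n) * ?q) z) < cmod (poly (- ?p) z)"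
        by (simp add: poly_monom norm_mult)
    qed simp
    have "poly ?p z = 0 \<and> cmod z < exp (- d / 2) \<longleftrightarrow> poly ?p z = 0 \<and> cmod z < 1" for z
    proof -
      have "cmod z < exp (- d / 2)" if "poly ?p z = 0" "cmod z < 1"
      proof (rule ccontr)
        assume "\<not> ?thesis"
        moreover have "exp (- d) < exp (- d / 2)" "1 < exp d" using d_pos by auto
        ultimately have "exp (- d) < cmod z" "cmod z < exp d" using \<open>cmod z < 1\<close> by linarith+
        then obtain w where "w \<in> strip d" "z = exp w" by (rule near_circle_as_exp)
        with p_nz that show False by blast
      qed
      moreover have "exp (- d / 2) \<le> 1" using d_pos by simp
      ultimately show ?thesis by (meson order_less_le_trans)
    qed
    then have roots_p: "root_count_in (- ?p) {z. cmod z < exp (- d / 2)} = root_count_in ?p {z. cmod z < 1}"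
      by (simp add: root_count_in_def)
    have "- ?p + monom 1 (2 * n) * ?q = H_poly b0 b1 cm1 c0 n" by (simp add: H_poly_def)
    with Rouche roots_p show ?case by simp
  qed
qed

text \<open>
  For \<open>z = exp w\<close> the equation \<open>z\<^sup>2\<^sup>n = g z\<close> reads \<open>2 n w = G w + \<i> m\<close> with \<open>m\<close> a multiple of
  \<open>2 pi\<close>. The real number \<open>t\<close> belonging to this solution satisfies
  \<open>exp (2 \<i> n t) = exp (\<i> Im (G (\<i> t))) = exp (\<i> \<Psi> t)\<close>, hence is a phase root up to a multiple of
  \<open>2 pi\<close>, and \<open>exp (\<i> t + Re (G (\<i> t)) / (2 n))\<close> is the centre of its disc. Both points lie in the
  half-plane \<open>Re w \<le> ln 2\<close>, where \<open>exp\<close> has Lipschitz constant 2, so the distance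
  \<open>D / (4 n\<^sup>2)\<close> at most doubles.
\<close>
lemma roots_near_circle_in_disc:
  assumes \<Psi>: "\<And>t. g_fun b0 b1 cm1 c0 (cis t) = of_real (cmod (g_fun b0 b1 cm1 c0 (cis t))) * cis (\<Psi> t)"
    and "C > 1" "0 < \<Delta>" "\<Delta> < 1"
  shows "\<forall>\<^sub>F n in sequentially. \<forall>z. poly (H_poly b0 b1 cm1 c0 n) z = 0 \<longrightarrow>
     exp (- d) < cmod z \<longrightarrow> cmod z < exp d \<longrightarrow>
     (\<exists>t\<in>phase_roots \<Psi> n. z \<in> approx_disc b0 b1 cm1 c0 \<Delta> C D n t)"
proof -
  let ?p = "p_poly b0 b1 cm1 c0" and ?q = "q_poly b0 b1 cm1 c0" and ?g = "g_fun b0 b1 cm1 c0"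
  have "(\<lambda>n. c / (2 * real n)) \<longlonglongrightarrow> 0" by real_asymp
  then have "\<forall>\<^sub>F n in sequentially. c / (2 * real n) < ln 2"
    by (rule order_tendstoD) simp
  moreover have "\<forall>\<^sub>F n in sequentially. n > 0" by (rule eventually_gt_at_top)
  ultimately show ?thesis
    using solution_close_to_explicit_point
  proof eventually_elim
    case (elim n)
    then have "real n > 0" by simp
    have half: "Re u / (2 * real n) \<le> ln 2" if "\<bar>Re u\<bar> \<le> c" for u
    proof -
      have "Re u / (2 * real n) \<le> c / (2 * real n)" using that by (intro divide_right_mono) auto
      then show ?thesis using elim(1) by linarith
    qed
    show ?case
    proof (intro allI impI)
      fix z assume root: "poly (H_poly b0 b1 cm1 c0 n) z = 0"
        and "exp (- d) < cmod z" "cmod z < exp d"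
      then obtain w where w: "w \<in> strip d" "z = exp w" using near_circle_as_exp by blast
      have "z ^ (2 * n) * poly ?q z = poly ?p z"
        using root by (simp add: H_poly_def poly_monom)
      then have "z ^ (2 * n) = ?g z"
        using q_nz[OF w(1)] w(2) by (simp add: g_fun_def field_simps)
      then have "exp (2 * of_nat n * w) = exp (G w)"
        using exp_G[OF w(1)] w(2) by (simp flip: exp_of_nat_mult)
      then obtain k :: int where k: "2 * of_nat n * w = G w + of_real (2 * of_int k * pi) * \<i>"
        using exp_eq by auto
      define m where "m = 2 * of_int k * pi"
      have wm: "2 * of_nat n * w = G w + \<i> * of_real m"
        using k by (simp add: m_def mult.commute)
      then obtain t where t: "2 * real n * t = Im (G (\<i> * of_real t)) + m"
        and close: "cmod (w - (\<i> * of_real t + of_real (Re (G (\<i> * of_real t)) / (2 * real n))))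
          \<le> D / (4 * (real n)\<^sup>2)"
        using elim(3) w(1) by blast
      define s where "s = \<i> * complex_of_real t"
      have s: "s \<in> strip d" using d_pos by (simp add: s_def strip_def)
      have "cis t = exp s" by (simp add: s_def cis_conv_exp)
      define j where "j = \<lfloor>t / (2 * pi)\<rfloor>"
      define t' where "t' = t - 2 * pi * of_int j"
      have cis_t': "cis t' = cis t"
        by (simp add: t'_def cis_divide[symmetric] cis_multiple_2pi)
      have cis_nt': "cis (2 * real n * t') = cis (2 * real n * t)"
      proof -
        have "cis (2 * real n * t') = cis (2 * real n * t) / cis (2 * pi * of_int (2 * int n * j))"
          unfolding cis_divide t'_def by (rule arg_cong[where f = cis]) (simp add: algebra_simps)
        then show ?thesis by (simp add: cis_multiple_2pi del: of_int_mult)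
      qed
      have g: "?g (cis t') = exp (G s)" using exp_G[OF s] by (simp add: cis_t' \<open>cis t = exp s\<close>)
      have phase: "t' \<in> phase_roots \<Psi> n"
      proof -
        have "of_real (exp (Re (G s))) * cis (\<Psi> t') = of_real (exp (Re (G s))) * cis (Im (G s))"
          using \<Psi>[of t'] unfolding g norm_exp_eq_Re by (simp add: exp_eq_polar)
        then have "cis (\<Psi> t') = cis (Im (G s))" by simp
        also have "\<dots> = cis (2 * real n * t) / cis m"
          unfolding cis_divide using t by (simp add: s_def)
        also have "cis m = 1" using cis_multiple_2pi[of "of_int k"] by (simp add: m_def mult_ac)
        finally have "cis (2 * real n * t') = cis (\<Psi> t')" by (simp add: cis_nt')
        moreover have "0 \<le> t'"
          using mult_left_mono[OF of_int_floor_le[of "t / (2 * pi)"], of "2 * pi"]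
          by (simp add: t'_def j_def)
        moreover have "t' < 2 * pi"
          using floor_correct[of "t / (2 * pi)"]
          by (simp add: t'_def j_def pos_divide_less_eq algebra_simps)
        ultimately show ?thesis by (simp add: phase_roots_def)
      qed
      define w' where "w' = s + of_real (Re (G s) / (2 * real n))"
      have centre: "of_real (cmod (?g (cis t')) powr (1 / (2 * real n))) * cis t' = exp w'"
      proof -
        have "cmod (?g (cis t')) powr (1 / (2 * real n)) = exp (Re (G s) / (2 * real n))"
          unfolding g by (simp add: powr_def)
        then show ?thesis
          unfolding cis_t' w'_def \<open>cis t = exp s\<close> exp_add by (simp only: exp_of_real mult.commute)
      qed
      have "Re w \<le> ln 2"
      proof -
        have "Re (2 * of_nat n * w) = Re (G w)" unfolding wm by simp
        then have "Re w = Re (G w) / (2 * real n)" using \<open>real n > 0\<close> by (simp add: field_simps)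
        then show ?thesis using half Re_bound[OF w(1)] by simp
      qed
      moreover have "Re w' \<le> ln 2" using half[OF Re_bound[OF s]] by (simp add: w'_def s_def)
      ultimately have "cmod (exp w - exp w') \<le> exp (ln 2) * cmod (w - w')"
        by (rule cmod_exp_diff_le)
      also have "\<dots> \<le> 2 * (D / (4 * (real n)\<^sup>2))" using close by (simp add: w'_def s_def)
      also have "\<dots> = D / (2 * (real n)\<^sup>2)" by simp
      also have "\<dots> \<le> C * D / (2 * (1 - \<Delta>) * (real n)\<^sup>2)"
        using D_pos assms(2-4) \<open>real n > 0\<close>
        by (intro frac_le mult_pos_pos mult_right_mono) auto
      finally have "z \<in> approx_disc b0 b1 cm1 c0 \<Delta> C D n t'"
        unfolding approx_disc_def centre w(2) by (simp add: dist_norm norm_minus_commute)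
      with phase show "\<exists>t\<in>phase_roots \<Psi> n. z \<in> approx_disc b0 b1 cm1 c0 \<Delta> C D n t" by blast
    qed
  qed
qed

text \<open>
  Centres of discs have modulus \<open>\<bar>g\<bar>\<^sup>1\<^sup>/\<^sup>2\<^sup>n\<close> with \<open>\<bar>g\<bar>\<close> between \<open>exp (- c)\<close> and \<open>exp c\<close>, so the
  discs shrink to the unit circle, uniformly in \<open>t\<close>.
\<close>
lemma approx_disc_near_circle:
  "\<forall>\<^sub>F n in sequentially. \<forall>t z. z \<in> approx_disc b0 b1 cm1 c0 \<Delta> C D n t \<longrightarrow>
     exp (- d / 2) < cmod z \<and> cmod z < exp (d / 2)"
proof -
  define \<epsilon> where "\<epsilon> n = C * D / (2 * (1 - \<Delta>) * (real n)\<^sup>2)" for n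
  have "\<epsilon> \<longlonglongrightarrow> 0"
  proof -
    have "(\<lambda>n. C * D / (2 * (1 - \<Delta>)) * (1 / (real n)\<^sup>2)) \<longlonglongrightarrow> C * D / (2 * (1 - \<Delta>)) * 0"
      by (intro tendsto_mult tendsto_const) real_asymp
    then show ?thesis by (simp add: \<epsilon>_def[abs_def])
  qed
  have "(\<lambda>n. exp (c / (2 * real n)) + \<epsilon> n) \<longlonglongrightarrow> exp 0 + 0"
    by (rule tendsto_add[OF tendsto_exp \<open>\<epsilon> \<longlonglongrightarrow> 0\<close>]) real_asymp
  moreover have "(\<lambda>n. exp (- c / (2 * real n)) - \<epsilon> n) \<longlonglongrightarrow> exp 0 - 0"
    by (rule tendsto_diff[OF tendsto_exp \<open>\<epsilon> \<longlonglongrightarrow> 0\<close>]) real_asymp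
  ultimately have "\<forall>\<^sub>F n in sequentially. exp (c / (2 * real n)) + \<epsilon> n < exp (d / 2)"
    and "\<forall>\<^sub>F n in sequentially. exp (- c / (2 * real n)) - \<epsilon> n > exp (- d / 2)"
    using d_pos by (simp_all only: order_tendstoD exp_zero one_less_exp_iff exp_less_one_iff
      add_0_right diff_zero half_gt_zero_iff neg_less_0_iff_less minus_divide_left[symmetric])
  then show ?thesis
  proof eventually_elim
    case (elim n)
    show ?case
    proof (intro allI impI)
      fix t z assume z: "z \<in> approx_disc b0 b1 cm1 c0 \<Delta> C D n t"
      define s where "s = \<i> * complex_of_real t"
      have s: "s \<in> strip d" using d_pos by (simp add: s_def strip_def)
      define a where "a = cmod (g_fun b0 b1 cm1 c0 (cis t)) powr (1 / (2 * real n))"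
      have "a = exp (Re (G s) / (2 * real n))"
        using exp_G[OF s] by (simp add: a_def s_def cis_conv_exp powr_def)
      moreover have "- c / (2 * real n) \<le> Re (G s) / (2 * real n)" "Re (G s) / (2 * real n) \<le> c / (2 * real n)"
        using Re_bound[OF s] by (intro divide_right_mono; simp)+
      ultimately have a: "exp (- c / (2 * real n)) \<le> a" "a \<le> exp (c / (2 * real n))" by auto
      have "cmod (of_real a * cis t - z) \<le> \<epsilon> n"
        using z by (simp add: approx_disc_def a_def \<epsilon>_def dist_norm)
      moreover have "cmod (of_real a * cis t) = a" by (simp add: norm_mult a_def)
      ultimately have "\<bar>a - cmod z\<bar> \<le> \<epsilon> n"
        using norm_triangle_ineq3[of "of_real a * cis t" z] by linarith
      then show "exp (- d / 2) < cmod z \<and> cmod z < exp (d / 2)" using a elim by linarith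
    qed
  qed
qed

end

section \<open>The number of special roots\<close>

theorem theorem4p2:
  fixes b0 b1 cm1 c0 :: complex
    and R \<Psi> :: "real \<Rightarrow> real"
    and \<Delta> C D :: real
    and Q :: nat
  assumes "no_zeros_poles_on_circle b0 b1 cm1 c0"
    and "\<And>t. R differentiable (at t)" and "\<And>t. \<Psi> differentiable (at t)"
    and "\<And>t. R t = cmod (g_fun b0 b1 cm1 c0 (cis t))"
    and "\<And>t. g_fun b0 b1 cm1 c0 (cis t) = of_real (R t) * cis (\<Psi> t)"
    and "0 < \<Delta>" and "\<Delta> < 1" and "C > 1" and "D > 0"
    and "annulus_bounds b0 b1 cm1 c0 \<Delta> C D"
    and "root_count_in (p_poly b0 b1 cm1 c0) {z. cmod z < 1} = Q"
  shows "\<exists>N. \<forall>n\<ge>N. n \<ge> 1 \<longrightarrow>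
           root_count_in (H_poly b0 b1 cm1 c0 n) (special_roots b0 b1 cm1 c0 \<Psi> \<Delta> C D n) = 2 * Q"
proof -
  let ?H = "H_poly b0 b1 cm1 c0"
  obtain d G where "strip_logarithm d (ln C) D G b0 b1 cm1 c0"
    using ex_strip_logarithm[OF assms(1,6-10)] by blast
  then interpret strip_logarithm d "ln C" D G b0 b1 cm1 c0 .
  have \<Psi>: "g_fun b0 b1 cm1 c0 (cis t) = of_real (cmod (g_fun b0 b1 cm1 c0 (cis t))) * cis (\<Psi> t)" for t
    using assms(5)[of t] unfolding assms(4)[of t] .
  have "\<forall>\<^sub>F n in sequentially. n \<ge> 1" by (rule eventually_ge_at_top)
  then have "\<forall>\<^sub>F n in sequentially. root_count_in (?H n) (special_roots b0 b1 cm1 c0 \<Psi> \<Delta> C D n) = 2 * Q"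
    using root_count_H_inside roots_near_circle_in_disc[OF \<Psi> assms(8,6,7)]
      approx_disc_near_circle[of \<Delta> C]
  proof eventually_elim
    case (elim n)
    let ?r = "exp (- d / 2)"
    have H0: "poly (?H n) 0 \<noteq> 0"
      using elim(1) by (simp add: H_poly_def poly_monom p_poly_def zero_power)
    then have "?H n \<noteq> 0" by auto
    have inv: "inverse ?r = exp (d / 2)" by (simp flip: exp_minus)
    have wide: "exp (- d) < ?r" "exp (d / 2) < exp d" "?r < exp (d / 2)" using d_pos by auto
    \<comment> \<open>The regular roots are exactly the roots in the annulus between the two circles.\<close>
    have "poly (?H n) z = 0 \<and> z \<in> special_roots b0 b1 cm1 c0 \<Psi> \<Delta> C D n \<longleftrightarrow>
        poly (?H n) z = 0 \<and> z \<in> {z. cmod z < ?r} \<union> {z. cmod z > inverse ?r}" for z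
    proof (cases "poly (?H n) z = 0")
      case True
      have "z \<in> special_roots b0 b1 cm1 c0 \<Psi> \<Delta> C D n \<longleftrightarrow>
          \<not> (\<exists>t\<in>phase_roots \<Psi> n. z \<in> approx_disc b0 b1 cm1 c0 \<Delta> C D n t)"
        using True by (auto simp: special_roots_def regular_roots_def)
      also have "\<dots> \<longleftrightarrow> cmod z < ?r \<or> cmod z > exp (d / 2)"
      proof
        assume "\<not> (\<exists>t\<in>phase_roots \<Psi> n. z \<in> approx_disc b0 b1 cm1 c0 \<Delta> C D n t)"
        then have "\<not> (exp (- d) < cmod z \<and> cmod z < exp d)" using elim(3) True by blast
        then show "cmod z < ?r \<or> cmod z > exp (d / 2)" using wide by linarith
      next
        assume "cmod z < ?r \<or> cmod z > exp (d / 2)"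
        then show "\<not> (\<exists>t\<in>phase_roots \<Psi> n. z \<in> approx_disc b0 b1 cm1 c0 \<Delta> C D n t)"
          using elim(4) by (meson less_asym)
      qed
      finally show ?thesis unfolding inv by simp
    qed simp
    then have "root_count_in (?H n) (special_roots b0 b1 cm1 c0 \<Psi> \<Delta> C D n)
        = root_count_in (?H n) ({z. cmod z < ?r} \<union> {z. cmod z > inverse ?r})"
      unfolding root_count_in_def by simp
    also have "\<dots> = root_count_in (?H n) {z. cmod z < ?r} + root_count_in (?H n) {z. cmod z > inverse ?r}"
    proof (rule root_count_in_Un[OF \<open>?H n \<noteq> 0\<close>])
      show "{z. cmod z < ?r} \<inter> {z. cmod z > inverse ?r} = {}"
        unfolding inv disjoint_iff using wide(3) by (metis less_asym less_trans mem_Collect_eq)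
    qed
    also have "root_count_in (?H n) {z. cmod z > inverse ?r} = root_count_in (?H n) {z. cmod z < ?r}"
      using H_poly_antipalindromic[OF elim(1)] H0 \<open>?H n \<noteq> 0\<close>
      by (intro root_count_in_outside) auto
    finally show ?case using elim(2) assms(11) by simp
  qed
  then show ?thesis unfolding eventually_sequentially by blast
qed

end
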